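(* For every $t\in[0,T]$, $y\in L^2(0,T;\mathbb{R}^r)$ and $\theta\in(0,\infty)$ there exists exactly one solution to the minimization problem $$\min_{x\in\mathbb{R}^n}\ \frac1\theta\ln\left(\frac1N\sum_{k=1}^N e^{\theta\left(\|x-\widehat{x}_k(t)\|_{P_k(t)}^2+r_k(t)\right)}\right).$$ The solution, denoted by $\widehat{x}_\theta(t)$, satisfies $$\widehat{x}_\theta(t)=\left(\sum_{k=1}^N e^{\theta\left(\|\widehat{x}_\theta(t)-\widehat{x}_k(t)\|_{P_k(t)}^2+r_k(t)\right)}P_k(t)\right)^{-1}\sum_{k=1}^N e^{\theta\left(\|\widehat{x}_\theta(t)-\widehat{x}_k(t)\|_{P_k(t)}^2+r_k(t)\right)}P_k(t)\widehat{x}_k(t)$$ and is the only element of $\mathbb{R}^n$ satisfying this relation.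
   Context: Setting. Fix $T>0$, $n,m,r\in\mathbb{N}$, $B\in\mathbb{R}^{n\times m}$, $C\in\mathbb{R}^{r\times n}$, $x_0\in\mathbb{R}^n$. $\|\cdot\|$ is the Euclidean norm, and $\|x\|_M^2=x^\top M x$ for a symmetric positive definite matrix $M$. Let $\Sigma=\Sigma_A\times\Sigma_\Gamma\times\Sigma_R\times\Sigma_Q$ be a product of finite nonempty sets, $\Sigma=\{\sigma_1,\dots,\sigma_N\}$, $N=|\Sigma|$. To each $\sigma=(\sigma_A,\sigma_\Gamma,\sigma_R,\sigma_Q)$ are assigned matrices $A_\sigma\in\mathbb{R}^{n\times n}$ (depending on $\sigma_A$ only) and symmetric positive definite matrices $\Gamma_\sigma\in\mathbb{R}^{n\times n}$, $R_\sigma\in\mathbb{R}^{m\times m}$, $Q_\sigma\in\mathbb{R}^{r\times r}$ (depending only on $\sigma_\Gamma$, $\sigma_R$, $\sigma_Q$ respectively). Index $k$ means $\sigma=\sigma_k$. For each $k$, $\Pi_k$ is the unique solution on $[0,T]$ of $\dot\Pi_k = A_k\Pi_k+\Pi_kA_k^\top-\Pi_kC^\top Q_k^{-1}C\Pi_k+BR_kB^\top$, $\Pi_k(0)=\Gamma_k$ (symmetric positive definite for all $t$), $P_k(t)=\Pi_k(t)^{-1}$ (infinitely differentiable in $t$), and, for a given output $y\in L^2(0,T;\mathbb{R}^r)$, $\widehat{x}_k\in H^1(0,T;\mathbb{R}^n)$ solves $\dot{\widehat{x}}_k=A_k\widehat{x}_k+\Pi_kC^\top Q_k^{-1}(y-C\widehat{x}_k)$,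 $\widehat{x}_k(0)=x_0$. Set $r_k(t)=\int_0^t\|y(s)-C\widehat{x}_k(s)\|_{Q_k^{-1}}^2\,ds$. *)

theory Defs
  imports "HOL-Analysis.Analysis"
begin

definition spd :: "real ^ 'n ^ 'n \<Rightarrow> bool" where
  "spd M \<longleftrightarrow> transpose M = M \<and> (\<forall>x. x \<noteq> 0 \<longrightarrow> 0 < x \<bullet> (M *v x))"

definition wnorm2 :: "real ^ 'n ^ 'n \<Rightarrow> real ^ 'n \<Rightarrow> real" where
  "wnorm2 M x = x \<bullet> (M *v x)"

text \<open>Lebesgue and Sobolev spaces on the open interval from 0 to T. Elements are functions, not
  equivalence classes modulo null sets, and their values outside the interval are irrelevant.\<close>

definition L2 :: "real \<Rightarrow> (real \<Rightarrow> 'a::euclidean_space) set" where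
  "L2 T = {f. f \<in> borel_measurable (lebesgue_on {0<..<T}) \<and>
              integrable (lebesgue_on {0<..<T}) (\<lambda>t. (norm (f t))\<^sup>2)}"

definition test_function :: "real \<Rightarrow> (real \<Rightarrow> real) \<Rightarrow> bool" where
  "test_function T \<phi> \<longleftrightarrow>
     (\<forall>k t. (deriv ^^ k) \<phi> field_differentiable (at t)) \<and>
     (\<exists>a b. 0 < a \<and> b < T \<and> (\<forall>t. t \<notin> {a..b} \<longrightarrow> \<phi> t = 0))"

definition weak_derivative :: "real \<Rightarrow> (real \<Rightarrow> 'a::euclidean_space) \<Rightarrow> (real \<Rightarrow> 'a) \<Rightarrow> bool" where
  "weak_derivative T x v \<longleftrightarrow>
     (\<forall>\<phi>. test_function T \<phi> \<longrightarrow>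
        (LINT t|lebesgue_on {0<..<T}. deriv \<phi> t *\<^sub>R x t) =
        - (LINT t|lebesgue_on {0<..<T}. \<phi> t *\<^sub>R v t))"

definition H1 :: "real \<Rightarrow> (real \<Rightarrow> 'a::euclidean_space) set" where
  "H1 T = {x \<in> L2 T. \<exists>v \<in> L2 T. weak_derivative T x v}"

definition riccati_solution ::
  "real \<Rightarrow> real ^ 'n ^ 'n \<Rightarrow> real ^ 'm ^ 'n \<Rightarrow> real ^ 'n ^ 'r \<Rightarrow> real ^ 'n ^ 'n \<Rightarrow> real ^ 'm ^ 'm \<Rightarrow>
   real ^ 'r ^ 'r \<Rightarrow> (real \<Rightarrow> real ^ 'n ^ 'n) \<Rightarrow> bool" where
  "riccati_solution T A B C \<Gamma> R Q \<Pi>s \<longleftrightarrow>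
     \<Pi>s 0 = \<Gamma> \<and>
     (\<forall>t\<in>{0..T}. (\<Pi>s has_vector_derivative
        A ** \<Pi>s t + \<Pi>s t ** transpose A
        - \<Pi>s t ** transpose C ** matrix_inv Q ** C ** \<Pi>s t
        + B ** R ** transpose B) (at t within {0..T}))"

text \<open>The output is only square integrable, so the equation holds in the sense of weak derivatives.
  Continuity on the closed interval selects the representative of the H1-class for which the
  initial condition and point evaluation are meaningful.\<close>

definition observer_solution ::
  "real \<Rightarrow> real ^ 'n ^ 'n \<Rightarrow> real ^ 'n ^ 'r \<Rightarrow> real ^ 'r ^ 'r \<Rightarrow> real ^ 'n \<Rightarrow>
   (real \<Rightarrow> real ^ 'n ^ 'n) \<Rightarrow> (real \<Rightarrow> real ^ 'r) \<Rightarrow> (real \<Rightarrow> real ^ 'n) \<Rightarrow> bool" where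
  "observer_solution T A C Q x0 \<Pi>s y x \<longleftrightarrow>
     x \<in> H1 T \<and> continuous_on {0..T} x \<and> x 0 = x0 \<and>
     weak_derivative T x
       (\<lambda>t. A *v x t + (\<Pi>s t ** transpose C ** matrix_inv Q) *v (y t - C *v x t))"

definition residual ::
  "real ^ 'n ^ 'r \<Rightarrow> real ^ 'r ^ 'r \<Rightarrow> (real \<Rightarrow> real ^ 'r) \<Rightarrow> (real \<Rightarrow> real ^ 'n) \<Rightarrow> real \<Rightarrow> real" where
  "residual C Q y x t = (LINT s|lebesgue_on {0..t}. wnorm2 (matrix_inv Q) (y s - C *v x s))"

text \<open>In the following, for a fixed time, P k, z k and \<rho> k stand for the weight matrix, the
  observer state and the accumulated residual of the parameter k in the finite index set K.\<close>

definition expweight ::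
  "real \<Rightarrow> ('k \<Rightarrow> real ^ 'n ^ 'n) \<Rightarrow> ('k \<Rightarrow> real ^ 'n) \<Rightarrow> ('k \<Rightarrow> real) \<Rightarrow> real ^ 'n \<Rightarrow> 'k \<Rightarrow> real" where
  "expweight \<theta> P z \<rho> x k = exp (\<theta> * (wnorm2 (P k) (x - z k) + \<rho> k))"

definition cost ::
  "real \<Rightarrow> 'k set \<Rightarrow> ('k \<Rightarrow> real ^ 'n ^ 'n) \<Rightarrow> ('k \<Rightarrow> real ^ 'n) \<Rightarrow> ('k \<Rightarrow> real) \<Rightarrow> real ^ 'n \<Rightarrow> real" where
  "cost \<theta> K P z \<rho> x = 1 / \<theta> * ln (1 / real (card K) * (\<Sum>k\<in>K. expweight \<theta> P z \<rho> x k))"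

definition weight_matrix ::
  "real \<Rightarrow> 'k set \<Rightarrow> ('k \<Rightarrow> real ^ 'n ^ 'n) \<Rightarrow> ('k \<Rightarrow> real ^ 'n) \<Rightarrow> ('k \<Rightarrow> real) \<Rightarrow> real ^ 'n \<Rightarrow>
   real ^ 'n ^ 'n" where
  "weight_matrix \<theta> K P z \<rho> x = (\<Sum>k\<in>K. expweight \<theta> P z \<rho> x k *\<^sub>R P k)"

definition weighted_average ::
  "real \<Rightarrow> 'k set \<Rightarrow> ('k \<Rightarrow> real ^ 'n ^ 'n) \<Rightarrow> ('k \<Rightarrow> real ^ 'n) \<Rightarrow> ('k \<Rightarrow> real) \<Rightarrow> real ^ 'n \<Rightarrow>
   real ^ 'n" where
  "weighted_average \<theta> K P z \<rho> x =
     matrix_inv (weight_matrix \<theta> K P z \<rho> x) *v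
       (\<Sum>k\<in>K. expweight \<theta> P z \<rho> x k *\<^sub>R (P k *v z k))"

end

theory Submission
  imports Defs
begin

text \<open>
  At a fixed time the statement is one of finite-dimensional convex optimization, with the
  differential equations entering through the positive definiteness of the matrices \<open>P\<^sub>k\<close>.

  Positive definiteness is inherited from the solution of the Riccati equation. That solution is
  symmetric because its difference with its transpose solves a linear homogeneous equation with
  zero initial value. It stays positive definite because \<open>\<epsilon> exp (- K t)\<close>, for suitable \<open>\<epsilon>\<close> and
  \<open>K\<close>, is a lower barrier for its smallest eigenvalue: at a first time of contact there is an
  eigenvector along which the quadratic form would decrease more slowly than the barrier
  (\<open>first_exit_pos_def\<close>, \<open>riccati_solution_spd\<close>).

  For the optimization, write \<open>J\<close> for the sum of the weights \<open>e\<^sub>k x = exp (\<theta> (q\<^sub>k x + \<rho>\<^sub>k))\<close>, where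
  \<open>q\<^sub>k x\<close> is the squared \<open>P\<^sub>k\<close>-norm of \<open>x - z\<^sub>k\<close>. The cost is an increasing function of \<open>J\<close>. Put
  \<open>G x = \<Sum>\<^sub>k e\<^sub>k x P\<^sub>k (x - z\<^sub>k)\<close>, so that the gradient of \<open>J\<close> is \<open>2 \<theta> G\<close>, and
  \<open>W x = \<Sum>\<^sub>k e\<^sub>k x P\<^sub>k\<close>. Expanding the quadratic forms exactly and using \<open>1 + u \<le> exp u\<close> gives
  \<open>J x + 2 \<theta> h \<bullet> G x + \<theta> h \<bullet> W x h \<le> J (x + h)\<close> for all \<open>x\<close> and \<open>h\<close>.
  This single inequality (\<open>expweight_sum_lower_bound\<close>) yields everything: at one point \<open>x\<close> it
  shows that \<open>J\<close> is coercive, so a minimizer exists, and at a zero of \<open>G\<close> it shows that this zero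
  is the strict global minimizer. Minimizers are zeros of \<open>G\<close>, and these are the solutions of the
  implicit equation since \<open>W\<close> is invertible; hence both are unique.
\<close>

section \<open>Symmetric positive definite matrices\<close>

lemma inner_transpose_mult:
  fixes M :: "real ^ 'n ^ 'm"
  shows "x \<bullet> (M *v y) = (transpose M *v x) \<bullet> y"
  by (simp add: dot_lmul_matrix)

lemma inner_symmetric_mult:
  fixes M :: "real ^ 'n ^ 'n"
  assumes "transpose M = M"
  shows "x \<bullet> (M *v y) = (M *v x) \<bullet> y"
  using inner_transpose_mult[of x M y] assms by simp

lemma scaleR_matrix_mult_vector:
  fixes M :: "real ^ 'n ^ 'm"
  shows "(c *\<^sub>R M) *v x = c *\<^sub>R (M *v x)"
  by (simp add: scaleR_matrix_vector_assoc)

lemma linear_mult_vector_left: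
  fixes x :: "real ^ 'n"
  shows "linear (\<lambda>M :: real ^ 'n ^ 'm. M *v x)"
  by (intro linearI) (simp_all add: matrix_vector_mult_add_rdistrib scaleR_matrix_mult_vector)

lemma sum_matrix_mult_vector:
  fixes M :: "'k \<Rightarrow> real ^ 'n ^ 'm"
  shows "(\<Sum>k\<in>K. M k) *v x = (\<Sum>k\<in>K. M k *v x)"
  by (rule linear_sum[OF linear_mult_vector_left])

lemma linear_transpose: "linear (transpose :: real ^ 'n ^ 'm \<Rightarrow> real ^ 'm ^ 'n)"
  by (intro linearI) (auto simp: transpose_def vec_eq_iff)

lemma bounded_bilinear_matrix_mult:
  "bounded_bilinear ((**) :: real ^ 'n ^ 'm \<Rightarrow> real ^ 'k ^ 'n \<Rightarrow> real ^ 'k ^ 'm)"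
proof -
  have "bilinear ((**) :: real ^ 'n ^ 'm \<Rightarrow> real ^ 'k ^ 'n \<Rightarrow> real ^ 'k ^ 'm)"
    unfolding bilinear_def
    by (intro conjI allI linearI)
      (auto simp: matrix_matrix_mult_def vec_eq_iff sum.distrib sum_distrib_left algebra_simps)
  then show ?thesis
    by (simp add: bilinear_conv_bounded_bilinear)
qed

lemma bounded_bilinear_matrix_vector_mult:
  "bounded_bilinear ((*v) :: real ^ 'n ^ 'm \<Rightarrow> real ^ 'n \<Rightarrow> real ^ 'm)"
proof -
  have "bilinear ((*v) :: real ^ 'n ^ 'm \<Rightarrow> real ^ 'n \<Rightarrow> real ^ 'm)"
    unfolding bilinear_def using linear_mult_vector_left matrix_vector_mul_linear by blast
  then show ?thesis
    by (simp add: bilinear_conv_bounded_bilinear)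
qed

lemma quadratic_form_bound:
  fixes M :: "real ^ 'n ^ 'n"
  obtains c where "0 \<le> c" "\<And>x. \<bar>x \<bullet> (M *v x)\<bar> \<le> c * (norm x)\<^sup>2"
proof -
  obtain c where c: "0 < c" "\<And>x. norm (M *v x) \<le> norm x * c"
    using bounded_linear.pos_bounded[OF matrix_vector_mul_bounded_linear[of M]] by blast
  have "\<bar>x \<bullet> (M *v x)\<bar> \<le> c * (norm x)\<^sup>2" for x
  proof -
    have "\<bar>x \<bullet> (M *v x)\<bar> \<le> norm x * norm (M *v x)"
      by (rule Cauchy_Schwarz_ineq2)
    also have "\<dots> \<le> norm x * (norm x * c)"
      by (intro mult_left_mono c) auto
    finally show ?thesis
      by (simp add: power2_eq_square mult_ac)
  qed
  with c(1) show thesis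
    by (intro that[of c]) auto
qed

text \<open>The bound is the smallest eigenvalue, found as the minimum of the form on the unit sphere.\<close>

lemma spd_coercive:
  fixes M :: "real ^ 'n ^ 'n"
  assumes "spd M"
  obtains c where "0 < c" "\<And>x. c * (norm x)\<^sup>2 \<le> x \<bullet> (M *v x)"
proof -
  let ?S = "sphere 0 1 :: (real ^ 'n) set"
  have cont: "continuous_on ?S (\<lambda>x. x \<bullet> (M *v x))"
    by (intro continuous_intros linear_continuous_on matrix_vector_mul_bounded_linear)
  have "?S \<noteq> {}"
    by simp
  from continuous_attains_inf[OF compact_sphere this cont]
  obtain u where u: "u \<in> ?S" "\<And>x. x \<in> ?S \<Longrightarrow> u \<bullet> (M *v u) \<le> x \<bullet> (M *v x)"
    by blast
  have "(u \<bullet> (M *v u)) * (norm x)\<^sup>2 \<le> x \<bullet> (M *v x)" for x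
  proof (cases "x = 0")
    case False
    have "u \<bullet> (M *v u) \<le> (x /\<^sub>R norm x) \<bullet> (M *v (x /\<^sub>R norm x))"
      using False by (intro u(2)) auto
    also have "\<dots> = x \<bullet> (M *v x) / (norm x)\<^sup>2"
      by (simp add: matrix_vector_mult_scaleR power2_eq_square divide_simps)
    finally show ?thesis
      using False by (simp add: field_simps)
  qed auto
  moreover have "0 < u \<bullet> (M *v u)"
    using u(1) assms by (cases "u = 0") (auto simp: spd_def)
  ultimately show thesis
    using that by blast
qed

lemma spd_invertible:
  assumes "spd M"
  shows "invertible M"
proof -
  have "x = 0" if "M *v x = 0" for x
    using that assms by (force simp: spd_def)
  then show ?thesis
    unfolding invertible_left_inverse matrix_left_invertible_ker by blast
qed

lemma matrix_inv_inverse: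
  assumes "invertible M"
  shows "M ** matrix_inv M = mat 1" "matrix_inv M ** M = mat 1"
  using someI_ex[OF assms[unfolded invertible_def]] unfolding matrix_inv_def by blast+

lemma matrix_mult_eq_iff_inv:
  assumes "invertible M"
  shows "M *v x = b \<longleftrightarrow> x = matrix_inv M *v b"
  by (auto simp: matrix_vector_mul_assoc matrix_inv_inverse[OF assms])

lemma spd_matrix_inv:
  assumes "spd M"
  shows "spd (matrix_inv M)"
proof -
  let ?N = "matrix_inv M"
  have inv: "M ** ?N = mat 1" "?N ** M = mat 1"
    using matrix_inv_inverse[OF spd_invertible[OF assms]] .
  have sym: "transpose M = M"
    using assms by (simp add: spd_def)
  have "transpose ?N ** M = mat 1"
    using inv(1) sym by (metis matrix_transpose_mul transpose_mat)
  then have "transpose ?N = ?N"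
    by (metis inv(1) matrix_mul_assoc matrix_mul_lid matrix_mul_rid)
  moreover have "0 < x \<bullet> (?N *v x)" if "x \<noteq> 0" for x
  proof -
    have x: "x = M *v (?N *v x)"
      by (simp add: matrix_vector_mul_assoc inv)
    with that have "?N *v x \<noteq> 0"
      by force
    then have "0 < (?N *v x) \<bullet> (M *v (?N *v x))"
      using assms by (simp add: spd_def)
    with x show ?thesis
      by (simp add: inner_commute)
  qed
  ultimately show ?thesis
    by (simp add: spd_def)
qed

text \<open>If \<open>v\<close> minimizes the form with value zero, then the form has zero derivative at \<open>v\<close>
  in every direction.\<close>

lemma semidefinite_null_vector:
  fixes M :: "real ^ 'n ^ 'n"
  assumes sym: "transpose M = M" and psd: "\<And>x. 0 \<le> x \<bullet> (M *v x)" and "v \<bullet> (M *v v) = 0"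
  shows "M *v v = 0"
proof -
  let ?w = "M *v v"
  obtain c where c: "0 \<le> c" "\<bar>?w \<bullet> (M *v ?w)\<bar> \<le> c * (norm ?w)\<^sup>2"
    using quadratic_form_bound by metis
  \<comment> \<open>At this step length the second-order term is at most half of the first-order term.\<close>
  define s where "s = 1 / (1 + c)"
  have s: "0 < s" "s * c \<le> 1"
    using c(1) by (auto simp: s_def divide_simps)
  have "0 \<le> (v - s *\<^sub>R ?w) \<bullet> (M *v (v - s *\<^sub>R ?w))"
    by (rule psd)
  also have "\<dots> = - (2 * s) * (norm ?w)\<^sup>2 + s\<^sup>2 * (?w \<bullet> (M *v ?w))"
    using assms(3) inner_symmetric_mult[OF sym, of v ?w] unfolding power2_norm_eq_inner
    by (simp add: matrix_vector_mult_diff_distrib matrix_vector_mult_scaleR inner_diff_left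
        inner_diff_right power2_eq_square algebra_simps)
  also have "\<dots> \<le> - (2 * s) * (norm ?w)\<^sup>2 + s\<^sup>2 * (c * (norm ?w)\<^sup>2)"
    using c(2) by (intro add_left_mono mult_left_mono) auto
  also have "\<dots> = s * (norm ?w)\<^sup>2 * (s * c - 2)"
    by (simp add: power2_eq_square algebra_simps)
  also have "\<dots> \<le> s * (norm ?w)\<^sup>2 * (- 1)"
    using s by (intro mult_left_mono) auto
  finally have "s * (norm ?w)\<^sup>2 \<le> 0"
    by simp
  with s(1) show ?thesis
    by (simp add: mult_le_0_iff)
qed

section \<open>Positive definiteness of the Riccati solution\<close>

lemma gronwall_zero:
  fixes f :: "real \<Rightarrow> 'a::real_inner"
  assumes deriv: "\<And>t. t \<in> {0..T} \<Longrightarrow> (f has_vector_derivative f' t) (at t within {0..T})"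
    and bound: "\<And>t. t \<in> {0..T} \<Longrightarrow> norm (f' t) \<le> K * norm (f t)"
    and "f 0 = 0" and t: "t \<in> {0..T}"
  shows "f t = 0"
proof -
  let ?g = "\<lambda>s. exp (- (2 * K) * s) * (f s \<bullet> f s)"
  let ?g' = "\<lambda>s. exp (- (2 * K) * s) * (2 * (f s \<bullet> f' s) - 2 * K * (f s \<bullet> f s))"
  have g: "(?g has_real_derivative ?g' s) (at s within {0..T})" if "s \<in> {0..T}" for s
  proof -
    have "((\<lambda>s. f s \<bullet> f s) has_vector_derivative (f s \<bullet> f' s + f' s \<bullet> f s)) (at s within {0..T})"
      by (rule bounded_bilinear.has_vector_derivative[OF bounded_bilinear_inner deriv deriv])
        (use that in auto)
    then have "((\<lambda>s. f s \<bullet> f s) has_real_derivative (f s \<bullet> f' s + f' s \<bullet> f s)) (at s within {0..T})"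
      by (simp add: has_real_derivative_iff_has_vector_derivative)
    then show ?thesis
      by (auto intro!: derivative_eq_intros simp: algebra_simps inner_commute)
  qed
  have nonpos: "?g' s \<le> 0" if "s \<in> {0..T}" for s
  proof -
    have "f s \<bullet> f' s \<le> norm (f s) * norm (f' s)"
      by (rule norm_cauchy_schwarz)
    also have "\<dots> \<le> norm (f s) * (K * norm (f s))"
      by (intro mult_left_mono bound that) auto
    finally have "f s \<bullet> f' s \<le> K * (f s \<bullet> f s)"
      by (simp add: power2_norm_eq_inner[symmetric] power2_eq_square mult_ac)
    then show ?thesis
      by (simp add: mult_le_0_iff)
  qed
  have deriv_at: "(?g has_real_derivative ?g' s) (at s)" if "0 < s" "s < T" for s
    using g[of s] that by (simp add: at_within_Icc_at)
  have "continuous_on {0..T} ?g"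
    using g by (rule DERIV_continuous_on)
  then have cont: "continuous_on {0..t} ?g"
    by (rule continuous_on_subset) (use t in auto)
  have "?g t \<le> ?g 0"
  proof (rule DERIV_nonpos_imp_decreasing_open[OF _ _ cont])
    fix s assume "0 < s" "s < t"
    then show "\<exists>d. (?g has_real_derivative d) (at s) \<and> d \<le> 0"
      using deriv_at[of s] nonpos[of s] t by (intro exI[of _ "?g' s"]) auto
  qed (use t in auto)
  then have "f t \<bullet> f t \<le> 0"
    using \<open>f 0 = 0\<close> by (simp add: mult_le_0_iff)
  then show ?thesis
    using inner_ge_zero[of "f t"] inner_eq_zero_iff[of "f t"] by linarith
qed

text \<open>
  Only null vectors of \<open>M t\<close> need to be tested: at the first time at which the form vanishes on
  some unit vector \<open>v\<close>, the matrix is still positive semidefinite, so \<open>v\<close> lies in its kernel.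
  The form at \<open>v\<close> then increases into the value zero, contradicting that it was positive before.
\<close>

lemma first_exit_pos_def:
  fixes M M' :: "real \<Rightarrow> real ^ 'n ^ 'n"
  assumes deriv: "\<And>t. t \<in> {0..T} \<Longrightarrow> (M has_vector_derivative M' t) (at t within {0..T})"
    and sym: "\<And>t. t \<in> {0..T} \<Longrightarrow> transpose (M t) = M t"
    and init: "\<And>x. x \<noteq> 0 \<Longrightarrow> 0 < x \<bullet> (M 0 *v x)"
    and inward: "\<And>t v. t \<in> {0..T} \<Longrightarrow> v \<noteq> 0 \<Longrightarrow> M t *v v = 0 \<Longrightarrow> 0 < v \<bullet> (M' t *v v)"
    and t: "t \<in> {0..T}" and "x \<noteq> 0"
  shows "0 < x \<bullet> (M t *v x)"
proof (rule ccontr)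
  assume neg: "\<not> 0 < x \<bullet> (M t *v x)"
  let ?D = "{0..T} \<times> sphere (0 :: real ^ 'n) 1"
  let ?q = "\<lambda>p :: real \<times> (real ^ 'n). snd p \<bullet> (M (fst p) *v snd p)"
  let ?S = "{p \<in> ?D. ?q p \<le> 0}"
  have contM: "continuous_on {0..T} M"
    using deriv by (rule continuous_on_vector_derivative)
  have "continuous_on ?D (\<lambda>p. M (fst p))"
    by (rule continuous_on_compose2[OF contM]) (auto intro: continuous_intros)
  then have contq: "continuous_on ?D ?q"
    by (intro continuous_intros bounded_bilinear.continuous_on[OF bounded_bilinear_matrix_vector_mult])
  have "compact ?D"
    by (intro compact_Times) auto
  moreover have "closed ?S"
    using contq by (intro continuous_on_closed_Collect_le continuous_on_const)
      (auto intro: closed_Times)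
  ultimately have "compact ?S"
    by (metis (no_types, lifting) Collect_subset compact_Int_closed inf.absorb_iff2 mem_Collect_eq subsetI)
  have scaled: "(s, v /\<^sub>R norm v) \<in> ?S" if "s \<in> {0..T}" "v \<noteq> 0" "v \<bullet> (M s *v v) \<le> 0" for s v
    using that by (auto simp: matrix_vector_mult_scaleR mult_le_0_iff zero_le_mult_iff)
  then have "?S \<noteq> {}"
    using neg t \<open>x \<noteq> 0\<close> by force
  with \<open>compact ?S\<close> obtain p where p: "p \<in> ?S" "\<And>p'. p' \<in> ?S \<Longrightarrow> fst p \<le> fst p'"
    using continuous_attains_inf[of ?S fst] continuous_on_fst[OF continuous_on_id] by blast
  define \<tau> v where "\<tau> = fst p" and "v = snd p"
  have \<tau>: "\<tau> \<in> {0..T}" and v: "norm v = 1" "v \<bullet> (M \<tau> *v v) \<le> 0"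
    using p(1) by (auto simp: \<tau>_def v_def)
  have before: "0 < w \<bullet> (M s *v w)" if "s \<in> {0..T}" "s < \<tau>" "w \<noteq> 0" for s w
    using scaled[of s w] p(2)[of "(s, w /\<^sub>R norm w)"] that by (fastforce simp: \<tau>_def)
  have "v \<noteq> 0"
    using v(1) by auto
  have "\<tau> \<noteq> 0"
    using init[OF \<open>v \<noteq> 0\<close>] v(2) by auto
  with \<tau> have "0 < \<tau>"
    by auto
  \<comment> \<open>A nonpositive value at \<open>\<tau>\<close> forces a zero in \<open>{0..\<tau>}\<close>, which by minimality of \<open>\<tau>\<close> can
    only occur at \<open>\<tau>\<close> itself.\<close>
  have zero: "w \<bullet> (M \<tau> *v w) = 0" if w: "w \<bullet> (M \<tau> *v w) \<le> 0" for w
  proof (cases "w = 0")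
    case False
    have "continuous_on {0..\<tau>} (\<lambda>s. w \<bullet> (M s *v w))"
      using \<tau> by (intro continuous_intros bounded_bilinear.continuous_on[OF
            bounded_bilinear_matrix_vector_mult] continuous_on_subset[OF contM]) auto
    then obtain s where s: "0 \<le> s" "s \<le> \<tau>" "w \<bullet> (M s *v w) = 0"
      using IVT2'[of "\<lambda>s. w \<bullet> (M s *v w)" \<tau> 0 0] w init[OF False] \<open>0 < \<tau>\<close> by fastforce
    then show ?thesis
      using before[of s w] False \<tau> by fastforce
  qed auto
  then have psd: "0 \<le> w \<bullet> (M \<tau> *v w)" for w
    by (metis linear)
  have null: "M \<tau> *v v = 0"
    using semidefinite_null_vector[OF sym[OF \<tau>] psd zero[OF v(2)]] .
  have "((\<lambda>s. M s *v v) has_vector_derivative M' \<tau> *v v) (at \<tau> within {0..T})"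
    using bounded_linear.has_vector_derivative[OF
        linear_mult_vector_left[THEN linear_conv_bounded_linear[THEN iffD1]] deriv[OF \<tau>]] .
  from bounded_linear.has_vector_derivative[OF bounded_linear_inner_right this]
  have "((\<lambda>s. v \<bullet> (M s *v v)) has_real_derivative v \<bullet> (M' \<tau> *v v)) (at \<tau> within {0..T})"
    by (simp add: has_real_derivative_iff_has_vector_derivative)
  from has_real_derivative_pos_inc_left[OF this inward[OF \<tau> \<open>v \<noteq> 0\<close> null]]
  obtain d where d: "0 < d"
    "\<And>h. 0 < h \<Longrightarrow> \<tau> - h \<in> {0..T} \<Longrightarrow> h < d \<Longrightarrow> v \<bullet> (M (\<tau> - h) *v v) < v \<bullet> (M \<tau> *v v)"
    by blast
  define h where "h = min \<tau> (d / 2)"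
  have h: "0 < h" "\<tau> - h \<in> {0..T}" "h < d"
    using \<open>0 < \<tau>\<close> \<tau> d(1) by (auto simp: h_def min_def)
  show False
    using d(2)[OF h] before[of "\<tau> - h" v] h \<open>v \<noteq> 0\<close> null by simp
qed

lemma riccati_solution_symmetric:
  fixes A :: "real ^ 'n ^ 'n" and B :: "real ^ 'm ^ 'n" and C :: "real ^ 'n ^ 'r"
  assumes sol: "riccati_solution T A B C \<Gamma> R Q \<Pi>s"
    and spd: "spd \<Gamma>" "spd R" "spd Q" and t: "t \<in> {0..T}"
  shows "transpose (\<Pi>s t) = \<Pi>s t"
proof -
  define S where "S = transpose C ** matrix_inv Q ** C"
  define E where "E = B ** R ** transpose B"
  define F where "F s = A ** \<Pi>s s + \<Pi>s s ** transpose A - \<Pi>s s ** S ** \<Pi>s s + E" for s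
  define L where "L s = A - transpose (\<Pi>s s) ** S" for s
  define D where "D s = \<Pi>s s - transpose (\<Pi>s s)" for s
  have symS: "transpose S = S" and symE: "transpose E = E"
    using spd spd_matrix_inv[OF spd(3)]
    by (simp_all add: S_def E_def spd_def matrix_transpose_mul matrix_mul_assoc)
  have deriv: "(\<Pi>s has_vector_derivative F s) (at s within {0..T})" if "s \<in> {0..T}" for s
    using sol that by (simp add: riccati_solution_def F_def S_def E_def matrix_mul_assoc)
  interpret mm: bounded_bilinear "(**) :: real ^ 'n ^ 'n \<Rightarrow> real ^ 'n ^ 'n \<Rightarrow> real ^ 'n ^ 'n"
    by (rule bounded_bilinear_matrix_mult)
  interpret tr: bounded_linear "transpose :: real ^ 'n ^ 'n \<Rightarrow> real ^ 'n ^ 'n"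
    using linear_transpose by (simp add: linear_conv_bounded_linear)
  \<comment> \<open>The quadratic terms factor as \<open>X S X - Y S Y = D S X + Y S D\<close> with \<open>D = X - Y\<close>; since \<open>S\<close>
    is symmetric, the equation for \<open>D\<close> has the Lyapunov form below.\<close>
  have derivD: "(D has_vector_derivative (L s ** D s + D s ** transpose (L s)))
      (at s within {0..T})" if "s \<in> {0..T}" for s
  proof -
    have "F s - transpose (F s) = L s ** D s + D s ** transpose (L s)"
      by (simp add: F_def L_def D_def tr.add tr.diff matrix_transpose_mul symS symE
          mm.add_left mm.add_right mm.diff_left mm.diff_right matrix_mul_assoc)
    then show ?thesis
      unfolding D_def
      using has_vector_derivative_diff[OF deriv[OF that] tr.has_vector_derivative[OF deriv[OF that]]]
      by simp
  qed
  have "continuous_on {0..T} \<Pi>s"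
    using deriv by (rule continuous_on_vector_derivative)
  then have "continuous_on {0..T} L"
    unfolding L_def by (intro continuous_intros mm.continuous_on tr.continuous_on)
  then have "bounded (L ` {0..T})"
    by (intro compact_imp_bounded compact_continuous_image) auto
  then obtain l where l: "0 < l" "\<And>s. s \<in> {0..T} \<Longrightarrow> norm (L s) \<le> l"
    by (auto simp: bounded_pos)
  obtain b where b: "0 < b" "\<And>(X :: real ^ 'n ^ 'n) (Y :: real ^ 'n ^ 'n). norm (X ** Y) \<le> norm X * norm Y * b"
    using mm.pos_bounded by blast
  obtain c where c: "0 < c" "\<And>X :: real ^ 'n ^ 'n. norm (transpose X) \<le> norm X * c"
    using tr.pos_bounded by blast
  have "norm (L s ** D s + D s ** transpose (L s)) \<le> (l * b + l * c * b) * norm (D s)"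
    if "s \<in> {0..T}" for s
  proof -
    have "norm (L s ** D s) \<le> norm (L s) * norm (D s) * b"
      by (rule b)
    also have "\<dots> \<le> l * norm (D s) * b"
      using l(2)[OF that] b(1) by (intro mult_right_mono) auto
    finally have 1: "norm (L s ** D s) \<le> l * b * norm (D s)"
      by (simp add: mult_ac)
    have "norm (transpose (L s)) \<le> l * c"
      using c(2)[of "L s"] mult_right_mono[OF l(2)[OF that], of c] c(1) by linarith
    then have "norm (D s) * norm (transpose (L s)) * b \<le> norm (D s) * (l * c) * b"
      using b(1) by (intro mult_right_mono mult_left_mono) auto
    with b(2)[of "D s" "transpose (L s)"]
    have 2: "norm (D s ** transpose (L s)) \<le> l * c * b * norm (D s)"
      by (simp add: mult_ac)
    from 1 2 norm_triangle_ineq[of "L s ** D s" "D s ** transpose (L s)"] show ?thesis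
      by (simp add: algebra_simps)
  qed
  moreover have "D 0 = 0"
    using sol spd(1) by (simp add: D_def riccati_solution_def spd_def)
  ultimately have "D t = 0"
    using gronwall_zero[OF derivD _ _ t] by blast
  then show ?thesis
    by (simp add: D_def)
qed

text \<open>
  On a unit eigenvector \<open>v\<close> of \<open>\<Pi>s t\<close> with eigenvalue \<open>c\<close> the derivative of the form is at least
  \<open>2 c (v \<bullet> A v) - c\<^sup>2 (v \<bullet> S v)\<close> with \<open>S = C\<^sup>T Q\<inverse> C\<close>, the remaining term being nonnegative.
  For \<open>0 < c \<le> 1\<close> this is at least \<open>- c\<close> times a constant, hence an eigenvalue \<open>c = \<epsilon> exp (- K t)\<close> with
  large \<open>K\<close> cannot be reached from above.
\<close>

lemma riccati_solution_spd:
  fixes A :: "real ^ 'n ^ 'n" and B :: "real ^ 'm ^ 'n" and C :: "real ^ 'n ^ 'r"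
  assumes sol: "riccati_solution T A B C \<Gamma> R Q \<Pi>s"
    and spd: "spd \<Gamma>" "spd R" "spd Q" and t: "t \<in> {0..T}"
  shows "spd (\<Pi>s t)"
proof -
  define S where "S = transpose C ** matrix_inv Q ** C"
  define E where "E = B ** R ** transpose B"
  define F where "F s = A ** \<Pi>s s + \<Pi>s s ** transpose A - \<Pi>s s ** S ** \<Pi>s s + E" for s
  have deriv: "(\<Pi>s has_vector_derivative F s) (at s within {0..T})" if "s \<in> {0..T}" for s
    using sol that by (simp add: riccati_solution_def F_def S_def E_def matrix_mul_assoc)
  have sym: "transpose (\<Pi>s s) = \<Pi>s s" if "s \<in> {0..T}" for s
    using riccati_solution_symmetric[OF sol spd that] .
  have E: "0 \<le> v \<bullet> (E *v v)" for v
  proof -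
    let ?u = "transpose B *v v"
    have "v \<bullet> (E *v v) = ?u \<bullet> (R *v ?u)"
      unfolding E_def using inner_transpose_mult[of v B "R *v ?u"]
      by (simp only: matrix_vector_mul_assoc[symmetric])
    also have "\<dots> \<ge> 0"
      using spd(2) by (cases "?u = 0") (auto simp: spd_def less_imp_le simp del: transpose_matrix_vector)
    finally show ?thesis .
  qed
  obtain a where a: "0 \<le> a" "\<And>v. \<bar>v \<bullet> (A *v v)\<bar> \<le> a * (norm v)\<^sup>2"
    using quadratic_form_bound by blast
  obtain b where b: "0 \<le> b" "\<And>v. \<bar>v \<bullet> (S *v v)\<bar> \<le> b * (norm v)\<^sup>2"
    using quadratic_form_bound by blast
  obtain \<gamma> where \<gamma>: "0 < \<gamma>" "\<And>v. \<gamma> * (norm v)\<^sup>2 \<le> v \<bullet> (\<Gamma> *v v)"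
    using spd_coercive[OF spd(1)] by blast
  define K where "K = 2 * a + b + 1"
  define \<epsilon> where "\<epsilon> = min 1 (\<gamma> / 2)"
  have \<epsilon>: "0 < \<epsilon>" "\<epsilon> \<le> 1" "\<epsilon> < \<gamma>"
    using \<gamma>(1) by (auto simp: \<epsilon>_def min_def)
  define \<beta> where "\<beta> s = \<epsilon> * exp (- K * s)" for s
  define M where "M s = \<Pi>s s - \<beta> s *\<^sub>R mat 1" for s
  have M_mult: "M s *v v = \<Pi>s s *v v - \<beta> s *\<^sub>R v" for s v
    by (simp add: M_def matrix_vector_mult_diff_rdistrib scaleR_matrix_mult_vector)
  have "0 < x \<bullet> (M t *v x)" if "x \<noteq> 0" for x
  proof (rule first_exit_pos_def[where M = M and M' = "\<lambda>s. F s + (K * \<beta> s) *\<^sub>R mat 1" and T = T])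
    fix s assume s: "s \<in> {0..T}"
    have "(\<beta> has_real_derivative - (K * \<beta> s)) (at s within {0..T})"
      unfolding \<beta>_def by (auto intro!: derivative_eq_intros)
    from has_vector_derivative_diff[OF deriv[OF s] has_vector_derivative_scaleR[OF this
          has_vector_derivative_const[of "mat 1"]]]
    show "(M has_vector_derivative F s + (K * \<beta> s) *\<^sub>R mat 1) (at s within {0..T})"
      by (simp add: M_def[abs_def])
    show "transpose (M s) = M s"
      using sym[OF s] by (simp add: M_def linear_diff[OF linear_transpose] transpose_scalar)
    fix v :: "real ^ 'n" assume "v \<noteq> 0" and "M s *v v = 0"
    then have eig: "\<Pi>s s *v v = \<beta> s *\<^sub>R v"
      by (simp add: M_mult)
    have "0 \<le> K * s"
      using s a(1) b(1) by (simp add: K_def)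
    then have "\<epsilon> * exp (- K * s) \<le> 1 * 1"
      using \<epsilon> by (intro mult_mono) auto
    then have \<beta>: "0 < \<beta> s" "\<beta> s \<le> 1"
      using \<epsilon>(1) by (auto simp: \<beta>_def)
    have "v \<bullet> ((\<Pi>s s ** transpose A) *v v) = \<beta> s * (v \<bullet> (A *v v))"
      using inner_symmetric_mult[OF sym[OF s], of v "transpose A *v v"]
        inner_transpose_mult[of v "transpose A" v]
      by (simp add: eig matrix_vector_mul_assoc[symmetric] inner_commute
          del: transpose_matrix_vector)
    moreover have "v \<bullet> ((\<Pi>s s ** S ** \<Pi>s s) *v v) = (\<beta> s)\<^sup>2 * (v \<bullet> (S *v v))"
      using inner_symmetric_mult[OF sym[OF s], of v "S *v v"]
      by (simp add: eig matrix_vector_mul_assoc[symmetric] matrix_vector_mult_scaleR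
          power2_eq_square)
    moreover have "v \<bullet> ((A ** \<Pi>s s) *v v) = \<beta> s * (v \<bullet> (A *v v))"
      by (simp add: eig matrix_vector_mul_assoc[symmetric] matrix_vector_mult_scaleR)
    ultimately have F: "v \<bullet> (F s *v v)
        = 2 * \<beta> s * (v \<bullet> (A *v v)) - (\<beta> s)\<^sup>2 * (v \<bullet> (S *v v)) + v \<bullet> (E *v v)"
      by (simp add: F_def matrix_vector_mult_add_rdistrib matrix_vector_mult_diff_rdistrib
          inner_add_right inner_diff_right)
    have "2 * \<beta> s * (- (a * (norm v)\<^sup>2)) \<le> 2 * \<beta> s * (v \<bullet> (A *v v))"
      using a(2)[of v] \<beta>(1) by (intro mult_left_mono) auto
    moreover have "(\<beta> s)\<^sup>2 * (v \<bullet> (S *v v)) \<le> \<beta> s * (b * (norm v)\<^sup>2)"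
    proof -
      have "(\<beta> s)\<^sup>2 * (v \<bullet> (S *v v)) \<le> (\<beta> s)\<^sup>2 * (b * (norm v)\<^sup>2)"
        using b(2)[of v] by (intro mult_left_mono) auto
      also have "\<dots> \<le> \<beta> s * (b * (norm v)\<^sup>2)"
        using \<beta> b(1) by (intro mult_right_mono) (auto simp: power2_eq_square)
      finally show ?thesis .
    qed
    ultimately have "2 * \<beta> s * (- (a * (norm v)\<^sup>2)) - \<beta> s * (b * (norm v)\<^sup>2) \<le> v \<bullet> (F s *v v)"
      using E[of v] F by linarith
    moreover have "v \<bullet> ((F s + (K * \<beta> s) *\<^sub>R mat 1) *v v) = v \<bullet> (F s *v v) + K * \<beta> s * (norm v)\<^sup>2"
      by (simp add: matrix_vector_mult_add_rdistrib scaleR_matrix_mult_vector inner_add_right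
          power2_norm_eq_inner)
    moreover have "0 < \<beta> s * (norm v)\<^sup>2"
      using \<beta>(1) \<open>v \<noteq> 0\<close> by simp
    ultimately show "0 < v \<bullet> ((F s + (K * \<beta> s) *\<^sub>R mat 1) *v v)"
      by (simp add: K_def algebra_simps)
  next
    fix x :: "real ^ 'n" assume "x \<noteq> 0"
    have "\<epsilon> * (norm x)\<^sup>2 < \<gamma> * (norm x)\<^sup>2"
      using \<epsilon> \<open>x \<noteq> 0\<close> by simp
    with \<gamma>(2)[of x] sol show "0 < x \<bullet> (M 0 *v x)"
      by (simp add: M_mult \<beta>_def riccati_solution_def inner_diff_right power2_norm_eq_inner)
  qed (use t that in auto)
  then have "0 < x \<bullet> (\<Pi>s t *v x) - \<beta> t * (x \<bullet> x)" if "x \<noteq> 0" for x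
    using that by (simp add: M_mult inner_diff_right)
  moreover have "0 \<le> \<beta> t * (x \<bullet> x)" for x :: "real ^ 'n"
    using \<epsilon>(1) by (simp add: \<beta>_def)
  ultimately have "0 < x \<bullet> (\<Pi>s t *v x)" if "x \<noteq> 0" for x
    using that by (meson diff_gt_0_iff_gt le_less_trans)
  then show ?thesis
    using sym[OF t] by (simp add: spd_def)
qed

section \<open>Minimizing the exponential cost\<close>

text \<open>For symmetric \<open>P k\<close> this is, up to the factor \<open>2 \<theta>\<close>, the gradient of the sum of the
  weights.\<close>

definition weighted_offset ::
  "real \<Rightarrow> 'k set \<Rightarrow> ('k \<Rightarrow> real ^ 'n ^ 'n) \<Rightarrow> ('k \<Rightarrow> real ^ 'n) \<Rightarrow> ('k \<Rightarrow> real) \<Rightarrow> real ^ 'n \<Rightarrow>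
   real ^ 'n" where
  "weighted_offset \<theta> K P z \<rho> x = (\<Sum>k\<in>K. expweight \<theta> P z \<rho> x k *\<^sub>R (P k *v (x - z k)))"

lemma expweight_sum_pos:
  assumes "finite K" "K \<noteq> {}"
  shows "0 < (\<Sum>k\<in>K. expweight \<theta> P z \<rho> x k)"
  using assms by (intro sum_pos) (auto simp: expweight_def)

lemma wnorm2_add:
  assumes "transpose M = M"
  shows "wnorm2 M (u + h) = wnorm2 M u + 2 * (h \<bullet> (M *v u)) + h \<bullet> (M *v h)"
  using inner_symmetric_mult[OF assms, of u h]
  by (simp add: wnorm2_def matrix_vector_right_distrib inner_add_left inner_add_right inner_commute)

lemma weight_matrix_spd:
  assumes "finite K" "K \<noteq> {}" and P: "\<forall>k\<in>K. spd (P k)"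
  shows "spd (weight_matrix \<theta> K P z \<rho> x)"
proof -
  have "transpose (weight_matrix \<theta> K P z \<rho> x) = weight_matrix \<theta> K P z \<rho> x"
    using P unfolding weight_matrix_def linear_sum[OF linear_transpose]
    by (intro sum.cong) (auto simp: spd_def transpose_scalar)
  moreover have "0 < v \<bullet> (weight_matrix \<theta> K P z \<rho> x *v v)" if "v \<noteq> 0" for v
    unfolding weight_matrix_def sum_matrix_mult_vector inner_sum_right scaleR_matrix_mult_vector
    using assms(1,2) by (rule sum_pos) (use that P in \<open>auto simp: expweight_def spd_def\<close>)
  ultimately show ?thesis
    by (simp add: spd_def)
qed

text \<open>Each exponent is a quadratic polynomial in \<open>h\<close>, so bounding the exponential from below by its
  tangent keeps the second-order term, which carries the strict convexity.\<close>

lemma expweight_sum_lower_bound: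
  assumes P: "\<forall>k\<in>K. transpose (P k) = P k"
  shows "(\<Sum>k\<in>K. expweight \<theta> P z \<rho> x k) + 2 * \<theta> * (h \<bullet> weighted_offset \<theta> K P z \<rho> x)
      + \<theta> * (h \<bullet> (weight_matrix \<theta> K P z \<rho> x *v h))
    \<le> (\<Sum>k\<in>K. expweight \<theta> P z \<rho> (x + h) k)"
proof -
  let ?e = "expweight \<theta> P z \<rho>"
  have "?e x k + 2 * \<theta> * (?e x k * (h \<bullet> (P k *v (x - z k)))) + \<theta> * (?e x k * (h \<bullet> (P k *v h)))
      \<le> ?e (x + h) k" if "k \<in> K" for k
  proof -
    let ?d = "\<theta> * (2 * (h \<bullet> (P k *v (x - z k))) + h \<bullet> (P k *v h))"
    have "wnorm2 (P k) (x + h - z k)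
        = wnorm2 (P k) (x - z k) + (2 * (h \<bullet> (P k *v (x - z k))) + h \<bullet> (P k *v h))"
      using wnorm2_add[OF P[rule_format, OF that], of "x - z k" h] by (simp add: algebra_simps)
    then have "?e (x + h) k = ?e x k * exp ?d"
      by (simp only: expweight_def exp_add[symmetric] distrib_left add_ac)
    moreover have "?e x k * (1 + ?d) \<le> ?e x k * exp ?d"
      by (intro mult_left_mono) (auto simp: expweight_def)
    ultimately show ?thesis
      by (simp add: algebra_simps)
  qed
  then have "(\<Sum>k\<in>K. ?e x k + 2 * \<theta> * (?e x k * (h \<bullet> (P k *v (x - z k))))
      + \<theta> * (?e x k * (h \<bullet> (P k *v h)))) \<le> (\<Sum>k\<in>K. ?e (x + h) k)"
    by (rule sum_mono)
  then show ?thesis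
    by (simp add: weighted_offset_def weight_matrix_def sum_matrix_mult_vector inner_sum_right
        scaleR_matrix_mult_vector sum.distrib sum_distrib_left)
qed

lemma weighted_offset_eq_0_iff:
  assumes "finite K" "K \<noteq> {}" and "\<forall>k\<in>K. spd (P k)"
  shows "weighted_offset \<theta> K P z \<rho> x = 0 \<longleftrightarrow> x = weighted_average \<theta> K P z \<rho> x"
proof -
  let ?W = "weight_matrix \<theta> K P z \<rho> x"
  let ?b = "\<Sum>k\<in>K. expweight \<theta> P z \<rho> x k *\<^sub>R (P k *v z k)"
  have "weighted_offset \<theta> K P z \<rho> x = ?W *v x - ?b"
    by (simp add: weighted_offset_def weight_matrix_def sum_matrix_mult_vector
        scaleR_matrix_mult_vector matrix_vector_mult_diff_distrib scaleR_diff_right sum_subtractf)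
  with matrix_mult_eq_iff_inv[of ?W x ?b] show ?thesis
    using spd_invertible[OF weight_matrix_spd[OF assms]] by (simp add: weighted_average_def)
qed

lemma is_arg_min_cost_iff:
  assumes "finite K" "K \<noteq> {}" "0 < \<theta>"
  shows "is_arg_min (cost \<theta> K P z \<rho>) (\<lambda>x. x \<in> UNIV) x \<longleftrightarrow>
    (\<forall>x'. (\<Sum>k\<in>K. expweight \<theta> P z \<rho> x k) \<le> (\<Sum>k\<in>K. expweight \<theta> P z \<rho> x' k))"
proof -
  have "0 < card K"
    using assms by (simp add: card_gt_0_iff)
  then have "cost \<theta> K P z \<rho> x' < cost \<theta> K P z \<rho> x \<longleftrightarrow>
      (\<Sum>k\<in>K. expweight \<theta> P z \<rho> x' k) < (\<Sum>k\<in>K. expweight \<theta> P z \<rho> x k)" for x'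
    using assms(3) expweight_sum_pos[OF assms(1,2), of \<theta> P z \<rho>]
    by (simp add: cost_def divide_less_cancel)
  then show ?thesis
    by (auto simp: is_arg_min_def not_less)
qed

lemma continuous_on_expweight_sum:
  "continuous_on S (\<lambda>x. \<Sum>k\<in>K. expweight \<theta> P z \<rho> x k)"
  unfolding expweight_def wnorm2_def
  by (intro continuous_intros bounded_linear.continuous_on[OF matrix_vector_mul_bounded_linear])

text \<open>Only displacements with \<open>\<theta> c (norm h)\<^sup>2 \<le> 2 \<theta> (norm h) (norm G)\<close> can decrease the sum, where
  \<open>c\<close> is a coercivity constant of the weight matrix at the origin and \<open>G\<close> the offset there; so it
  suffices to minimize over a ball.\<close>

lemma ex_minimizer_expweight_sum:
  assumes "finite K" "K \<noteq> {}" and P: "\<forall>k\<in>K. spd (P k)" and "0 < \<theta>"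
  obtains x where "\<And>x'. (\<Sum>k\<in>K. expweight \<theta> P z \<rho> x k) \<le> (\<Sum>k\<in>K. expweight \<theta> P z \<rho> x' k)"
proof -
  let ?J = "\<lambda>x. \<Sum>k\<in>K. expweight \<theta> P z \<rho> x k"
  let ?G = "weighted_offset \<theta> K P z \<rho> 0"
  let ?W = "weight_matrix \<theta> K P z \<rho> 0"
  obtain c where c: "0 < c" "\<And>h. c * (norm h)\<^sup>2 \<le> h \<bullet> (?W *v h)"
    using spd_coercive[OF weight_matrix_spd[OF assms(1-3)]] by blast
  define r where "r = 2 * norm ?G / c"
  have r: "0 \<le> r"
    using c(1) by (simp add: r_def)
  have outside: "?J 0 \<le> ?J x" if "r < norm x" for x
  proof -
    have "2 * norm ?G \<le> c * norm x"
      using that c(1) by (simp add: r_def field_simps)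
    then have "norm x * (2 * norm ?G) \<le> norm x * (c * norm x)"
      by (intro mult_left_mono) auto
    also have "\<dots> \<le> x \<bullet> (?W *v x)"
      using c(2)[of x] by (simp add: power2_eq_square mult_ac)
    finally have "0 \<le> 2 * (x \<bullet> ?G) + x \<bullet> (?W *v x)"
      using Cauchy_Schwarz_ineq2[of x ?G] by (simp add: mult_ac)
    then have "0 \<le> \<theta> * (2 * (x \<bullet> ?G) + x \<bullet> (?W *v x))"
      using \<open>0 < \<theta>\<close> by simp
    moreover have "?J 0 + 2 * \<theta> * (x \<bullet> ?G) + \<theta> * (x \<bullet> (?W *v x)) \<le> ?J x"
      using expweight_sum_lower_bound[of K P \<theta> z \<rho> 0 x] P by (simp add: spd_def)
    ultimately show ?thesis
      by (simp add: algebra_simps)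
  qed
  have "cball (0 :: real ^ 'b) r \<noteq> {}"
    using r by simp
  then obtain x where x: "\<And>x'. x' \<in> cball 0 r \<Longrightarrow> ?J x \<le> ?J x'"
    using continuous_attains_inf[OF compact_cball _ continuous_on_expweight_sum] by metis
  have "?J x \<le> ?J x'" for x'
    using x[of x'] x[of 0] outside[of x'] r by fastforce
  then show thesis
    by (rule that)
qed

lemma weighted_offset_minimizer:
  assumes P: "\<forall>k\<in>K. transpose (P k) = P k" and "0 < \<theta>"
    and min: "\<And>x'. (\<Sum>k\<in>K. expweight \<theta> P z \<rho> x k) \<le> (\<Sum>k\<in>K. expweight \<theta> P z \<rho> x' k)"
  shows "weighted_offset \<theta> K P z \<rho> x = 0"
proof -
  let ?h = "weighted_offset \<theta> K P z \<rho> x"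
  let ?J = "\<lambda>s :: real. \<Sum>k\<in>K. expweight \<theta> P z \<rho> (x + s *\<^sub>R ?h) k"
  have "((\<lambda>s. expweight \<theta> P z \<rho> (x + s *\<^sub>R ?h) k) has_real_derivative
      2 * \<theta> * (expweight \<theta> P z \<rho> x k * (?h \<bullet> (P k *v (x - z k))))) (at 0)" if "k \<in> K" for k
  proof -
    have "wnorm2 (P k) (x + s *\<^sub>R ?h - z k) = wnorm2 (P k) (x - z k)
        + 2 * s * (?h \<bullet> (P k *v (x - z k))) + s\<^sup>2 * (?h \<bullet> (P k *v ?h))" for s
      using wnorm2_add[OF P[rule_format, OF that], of "x - z k" "s *\<^sub>R ?h"]
      by (simp add: algebra_simps matrix_vector_mult_scaleR power2_eq_square)
    then show ?thesis
      unfolding expweight_def by (auto intro!: derivative_eq_intros)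
  qed
  then have "(?J has_real_derivative
      (\<Sum>k\<in>K. 2 * \<theta> * (expweight \<theta> P z \<rho> x k * (?h \<bullet> (P k *v (x - z k)))))) (at 0)"
    by (rule DERIV_sum)
  also have "(\<Sum>k\<in>K. 2 * \<theta> * (expweight \<theta> P z \<rho> x k * (?h \<bullet> (P k *v (x - z k)))))
      = 2 * \<theta> * (?h \<bullet> ?h)"
    by (subst (3) weighted_offset_def) (simp add: inner_sum_right sum_distrib_left)
  finally have "2 * \<theta> * (?h \<bullet> ?h) = 0"
    by (rule DERIV_local_min[of _ _ 0 1]) (use min in auto)
  then show ?thesis
    using \<open>0 < \<theta>\<close> by simp
qed

lemma weighted_offset_zero_strict_minimizer:
  assumes "finite K" "K \<noteq> {}" and P: "\<forall>k\<in>K. spd (P k)" and "0 < \<theta>"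
    and zero: "weighted_offset \<theta> K P z \<rho> x = 0" and "x' \<noteq> x"
  shows "(\<Sum>k\<in>K. expweight \<theta> P z \<rho> x k) < (\<Sum>k\<in>K. expweight \<theta> P z \<rho> x' k)"
proof -
  have "0 < \<theta> * ((x' - x) \<bullet> (weight_matrix \<theta> K P z \<rho> x *v (x' - x)))"
    using weight_matrix_spd[OF assms(1-3)] \<open>0 < \<theta>\<close> \<open>x' \<noteq> x\<close> by (simp add: spd_def)
  then show ?thesis
    using expweight_sum_lower_bound[of K P \<theta> z \<rho> x "x' - x"] P zero by (simp add: spd_def)
qed

theorem lemma3p11:
  fixes T \<theta> t :: real
    and B :: "real ^ 'm ^ 'n" and C :: "real ^ 'n ^ 'r" and x0 :: "real ^ 'n"
    and \<Sigma>A :: "'a set" and \<Sigma>\<Gamma> :: "'g set" and \<Sigma>R :: "'b set" and \<Sigma>Q :: "'q set"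
    and \<Sigma> :: "('a \<times> 'g \<times> 'b \<times> 'q) set"
    and A :: "'a \<Rightarrow> real ^ 'n ^ 'n" and \<Gamma> :: "'g \<Rightarrow> real ^ 'n ^ 'n"
    and R :: "'b \<Rightarrow> real ^ 'm ^ 'm" and Q :: "'q \<Rightarrow> real ^ 'r ^ 'r"
    and \<Pi>s P :: "'a \<times> 'g \<times> 'b \<times> 'q \<Rightarrow> real \<Rightarrow> real ^ 'n ^ 'n"
    and y :: "real \<Rightarrow> real ^ 'r"
    and xhat :: "'a \<times> 'g \<times> 'b \<times> 'q \<Rightarrow> real \<Rightarrow> real ^ 'n"
    and \<rho> :: "'a \<times> 'g \<times> 'b \<times> 'q \<Rightarrow> real \<Rightarrow> real"
  assumes "0 < T"
    and "finite \<Sigma>A" "\<Sigma>A \<noteq> {}" and "finite \<Sigma>\<Gamma>" "\<Sigma>\<Gamma> \<noteq> {}"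
    and "finite \<Sigma>R" "\<Sigma>R \<noteq> {}" and "finite \<Sigma>Q" "\<Sigma>Q \<noteq> {}"
    and "\<Sigma> = \<Sigma>A \<times> \<Sigma>\<Gamma> \<times> \<Sigma>R \<times> \<Sigma>Q"
    and "\<forall>g\<in>\<Sigma>\<Gamma>. spd (\<Gamma> g)" and "\<forall>b\<in>\<Sigma>R. spd (R b)" and "\<forall>q\<in>\<Sigma>Q. spd (Q q)"
    and "\<forall>(a, g, b, q)\<in>\<Sigma>. riccati_solution T (A a) B C (\<Gamma> g) (R b) (Q q) (\<Pi>s (a, g, b, q))"
    and "\<forall>\<sigma>\<in>\<Sigma>. \<forall>s\<in>{0..T}. P \<sigma> s = matrix_inv (\<Pi>s \<sigma> s)"
    and "y \<in> L2 T"
    and "\<forall>(a, g, b, q)\<in>\<Sigma>.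
           observer_solution T (A a) C (Q q) x0 (\<Pi>s (a, g, b, q)) y (xhat (a, g, b, q))"
    and "\<forall>(a, g, b, q)\<in>\<Sigma>. \<forall>s\<in>{0..T}.
           \<rho> (a, g, b, q) s = residual C (Q q) y (xhat (a, g, b, q)) s"
    and "t \<in> {0..T}" and "0 < \<theta>"
  shows "(\<exists>!x. is_arg_min (cost \<theta> \<Sigma> (\<lambda>\<sigma>. P \<sigma> t) (\<lambda>\<sigma>. xhat \<sigma> t) (\<lambda>\<sigma>. \<rho> \<sigma> t)) (\<lambda>x. x \<in> UNIV) x) \<and>
    (\<forall>x. is_arg_min (cost \<theta> \<Sigma> (\<lambda>\<sigma>. P \<sigma> t) (\<lambda>\<sigma>. xhat \<sigma> t) (\<lambda>\<sigma>. \<rho> \<sigma> t)) (\<lambda>x. x \<in> UNIV) x \<longrightarrow>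
       invertible (weight_matrix \<theta> \<Sigma> (\<lambda>\<sigma>. P \<sigma> t) (\<lambda>\<sigma>. xhat \<sigma> t) (\<lambda>\<sigma>. \<rho> \<sigma> t) x) \<and>
       x = weighted_average \<theta> \<Sigma> (\<lambda>\<sigma>. P \<sigma> t) (\<lambda>\<sigma>. xhat \<sigma> t) (\<lambda>\<sigma>. \<rho> \<sigma> t) x \<and>
       (\<forall>x'. x' = weighted_average \<theta> \<Sigma> (\<lambda>\<sigma>. P \<sigma> t) (\<lambda>\<sigma>. xhat \<sigma> t) (\<lambda>\<sigma>. \<rho> \<sigma> t) x' \<longrightarrow> x' = x))"
proof -
  let ?P = "\<lambda>\<sigma>. P \<sigma> t" and ?z = "\<lambda>\<sigma>. xhat \<sigma> t" and ?\<rho> = "\<lambda>\<sigma>. \<rho> \<sigma> t"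
  let ?min = "is_arg_min (cost \<theta> \<Sigma> ?P ?z ?\<rho>) (\<lambda>x. x \<in> UNIV)"
  have fin: "finite \<Sigma>" "\<Sigma> \<noteq> {}"
    using assms(2-10) by auto
  have spd: "\<forall>\<sigma>\<in>\<Sigma>. spd (?P \<sigma>)"
  proof
    fix \<sigma> assume \<sigma>: "\<sigma> \<in> \<Sigma>"
    obtain a g b q where \<sigma>_eq: "\<sigma> = (a, g, b, q)"
      by (cases \<sigma>)
    with \<sigma> assms(10) have "g \<in> \<Sigma>\<Gamma>" "b \<in> \<Sigma>R" "q \<in> \<Sigma>Q"
      by auto
    then have "spd (\<Gamma> g)" "spd (R b)" "spd (Q q)"
      using assms(11-13) by auto
    moreover have "riccati_solution T (A a) B C (\<Gamma> g) (R b) (Q q) (\<Pi>s \<sigma>)"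
      using assms(14) \<sigma> \<sigma>_eq by auto
    ultimately have "spd (\<Pi>s \<sigma> t)"
      using riccati_solution_spd assms(19) by blast
    then show "spd (?P \<sigma>)"
      using spd_matrix_inv assms(15,19) \<sigma> by metis
  qed
  have sym: "\<forall>\<sigma>\<in>\<Sigma>. transpose (?P \<sigma>) = ?P \<sigma>"
    using spd by (simp add: spd_def)
  note min_iff = is_arg_min_cost_iff[OF fin \<open>0 < \<theta>\<close>, of ?P ?z ?\<rho>]
  note strict = weighted_offset_zero_strict_minimizer[OF fin spd \<open>0 < \<theta>\<close>]
  have crit: "weighted_offset \<theta> \<Sigma> ?P ?z ?\<rho> x = 0" if "?min x" for x
    using weighted_offset_minimizer[OF sym \<open>0 < \<theta>\<close>] that min_iff by blast
  have unique: "x' = x" if "weighted_offset \<theta> \<Sigma> ?P ?z ?\<rho> x = 0"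
    "weighted_offset \<theta> \<Sigma> ?P ?z ?\<rho> x' = 0" for x x'
    using strict[OF that(1), of x'] strict[OF that(2), of x] by fastforce
  have "\<exists>x. ?min x"
    using ex_minimizer_expweight_sum[OF fin spd \<open>0 < \<theta>\<close>] min_iff by metis
  then have "\<exists>!x. ?min x"
    using crit unique by blast
  moreover have "invertible (weight_matrix \<theta> \<Sigma> ?P ?z ?\<rho> x)" for x
    using spd_invertible[OF weight_matrix_spd[OF fin spd]] by blast
  moreover have "weighted_offset \<theta> \<Sigma> ?P ?z ?\<rho> x = 0 \<longleftrightarrow> x = weighted_average \<theta> \<Sigma> ?P ?z ?\<rho> x"
    for x
    using weighted_offset_eq_0_iff[OF fin spd] .
  ultimately show ?thesis
    using crit unique by metis
qed

end
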